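(* For integers $n\ge1$ let $$A_{n-1}=\sum_{i=1}^{n}\binom{n}{i}(-1)^i\log i.$$ Then $\lim_{n\to\infty}\left(A_n-\log\log n\right)=\gamma$, where $\gamma=0.577\ldots$ is the Euler constant. *)

theory Defs
  imports "HOL-Analysis.Analysis"
begin

end

theory Submission
  imports Defs "HOL-Real_Asymp.Real_Asymp"
begin

text \<open>
  The idea is to replace \<open>ln i\<close> by \<open>ln ((1 - q ^ i) / (1 - q))\<close>, whose limit for \<open>q \<rightarrow> 1\<close> is
  \<open>ln i\<close>.  Since the signed binomial coefficients with \<open>1 \<le> i \<le> n\<close> add up to \<open>- 1\<close>, the
  alternating sum becomes \<open>ln (1 - q) + G q\<close> with
  \<open>G q = (\<Sum>i=1..n. (n choose i) * (-1) ^ i * ln (1 - q ^ i))\<close>, and the logarithmic series together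
  with the binomial theorem turns this into the series of nonnegative terms
  \<open>G q = (\<Sum>j\<ge>1. (1 - (1 - q ^ j) ^ n) / j)\<close>.

  The factor \<open>1 - (1 - q ^ j) ^ n\<close> is close to \<open>1\<close> as long as \<open>n * q ^ j\<close> is large and close to \<open>0\<close>
  once \<open>n * q ^ j\<close> is small, so \<open>G q\<close> is close to a harmonic number \<open>harm m\<close>, where \<open>m\<close> is the
  position of the transition.  This is where Euler's constant comes from: for \<open>q = exp (- K / m)\<close>
  with fixed \<open>K\<close> and \<open>m \<rightarrow> \<infinity>\<close>, the quantity \<open>harm m + ln (1 - q)\<close> tends to
  \<open>euler_mascheroni + ln K\<close>.  Estimating the terms after the cut from above by Bernoulli's inequality,
  and those before the cut from below by \<open>n * x * (1 - x) ^ (n - 1) \<le> 1\<close>, gives for every \<open>K > 0\<close>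
  that the alternating sum differs from \<open>ln K + euler_mascheroni\<close> by at most \<open>n * exp (- K) / K\<close>
  upwards and \<open>(exp K - 1) / n\<close> downwards.  The choices \<open>K = ln n\<close> for the upper bound and
  \<open>K = ln n - ln (ln n)\<close> for the lower bound make both errors at most \<open>1 / ln n\<close>, while
  \<open>ln K = ln (ln n) + o(1)\<close> in either case.
\<close>

lemma sum_choose_alternating_power:
  fixes y :: real
  shows "(\<Sum>i=1..n. real (n choose i) * (-1) ^ i * y ^ i) = (1 - y) ^ n - 1"
proof -
  have "(1 - y) ^ n = (\<Sum>i\<le>n. real (n choose i) * (-1) ^ i * y ^ i)"
    using binomial_ring[of "-y" 1 n] by (simp add: power_minus[of y] mult.assoc)
  also have "\<dots> = 1 + (\<Sum>i=1..n. real (n choose i) * (-1) ^ i * y ^ i)"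
    by (simp add: atMost_atLeast0 sum.atLeast_Suc_atMost)
  finally show ?thesis by simp
qed

text \<open>
  Here and below the term with index \<open>j = 0\<close> vanishes because of the division by zero, so the series
  effectively starts at \<open>j = 1\<close>.
\<close>

lemma sums_ln_one_minus:
  fixes y :: real
  assumes "0 \<le> y" "y < 1"
  shows "(\<lambda>j. y ^ j / real j) sums - ln (1 - y)"
  using sums_minus[OF ln_series'[of "-y"]] assms by simp

lemma sums_alternating_ln_one_minus_power:
  fixes q :: real
  assumes q: "0 < q" "q < 1"
  shows "(\<lambda>j. (1 - (1 - q ^ j) ^ n) / real j)
           sums (\<Sum>i=1..n. real (n choose i) * (-1) ^ i * ln (1 - q ^ i))"
proof -
  have "(\<lambda>j. \<Sum>i=1..n. - (real (n choose i) * (-1) ^ i) * ((q ^ i) ^ j / real j))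
          sums (\<Sum>i=1..n. - (real (n choose i) * (-1) ^ i) * - ln (1 - q ^ i))"
  proof (intro sums_sum sums_mult sums_ln_one_minus)
    fix i assume "i \<in> {1..n}"
    then show "0 \<le> q ^ i" "q ^ i < 1"
      using q by (auto simp: power_less_one_iff)
  qed
  moreover have "(\<Sum>i=1..n. - (real (n choose i) * (-1) ^ i) * ((q ^ i) ^ j / real j))
                   = (1 - (1 - q ^ j) ^ n) / real j" for j
  proof -
    have "(\<Sum>i=1..n. - (real (n choose i) * (-1) ^ i) * ((q ^ i) ^ j / real j))
            = - (\<Sum>i=1..n. real (n choose i) * (-1) ^ i * (q ^ j) ^ i) / real j"
      by (simp add: sum_divide_distrib sum_negf power_mult[symmetric] mult.commute)
    then show ?thesis
      unfolding sum_choose_alternating_power by simp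
  qed
  ultimately show ?thesis by simp
qed

text \<open>
  The left-hand side is the probability of exactly one success in \<open>n\<close> independent trials.
\<close>

lemma binomial_one_success_le_1:
  fixes x :: real
  assumes "0 \<le> x" "x \<le> 1"
  shows "real n * x * (1 - x) ^ (n - 1) \<le> 1"
proof (cases "n = 0")
  case False
  have "real n * x * (1 - x) ^ (n - 1) = (\<Sum>k\<in>{1}. real (n choose k) * x ^ k * (1 - x) ^ (n - k))"
    by simp
  also have "\<dots> \<le> (\<Sum>k\<le>n. real (n choose k) * x ^ k * (1 - x) ^ (n - k))"
    using False assms by (intro sum_mono2) auto
  also have "\<dots> = (x + (1 - x)) ^ n"
    by (simp only: binomial_ring)
  finally show ?thesis by simp
qed simp

lemma one_minus_power_le:
  fixes q :: real
  assumes "0 < q" "q < 1"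
  shows "1 - q ^ j \<le> real j * (1 - q)"
  using Bernoulli_inequality[of "q - 1" j] assms by (simp add: algebra_simps)

text \<open>
  Before the cut, the defect \<open>(1 - q ^ j) ^ n / j\<close> of a term is at most \<open>(1 - q) / (n * q ^ j)\<close>.  Both
  factors \<open>1 - q ^ j\<close> and \<open>(1 - q ^ j) ^ (n - 1)\<close> matter: the first cancels the \<open>1 / j\<close>, which would
  make the sum of the bounds grow without limit as \<open>m \<rightarrow> \<infinity>\<close>, and the second supplies the factor \<open>1 / n\<close>.
\<close>

lemma alternating_ln_one_minus_power_ge_harm:
  fixes q :: real
  assumes q: "0 < q" "q < 1" and n: "n \<ge> 1"
  shows "harm m - (1 / q ^ m - 1) / real n
           \<le> (\<Sum>i=1..n. real (n choose i) * (-1) ^ i * ln (1 - q ^ i))"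
proof -
  let ?b = "\<lambda>j. (1 - (1 - q ^ j) ^ n) / real j"
  note b = sums_alternating_ln_one_minus_power[OF q, of n]
  have qj: "0 < q ^ j" "q ^ j \<le> 1" for j
    using q by (auto simp: power_le_one)
  (* the subtracted terms telescope *)
  have termwise: "1 / real j - (1 / q ^ j - 1 / q ^ (j - 1)) / real n \<le> ?b j" if "j \<in> {1..m}" for j
  proof -
    have j: "j \<ge> 1" using that by simp
    have "(1 - q ^ j) ^ n * (real n * q ^ j)
            = (1 - q ^ j) * (real n * q ^ j * (1 - q ^ j) ^ (n - 1))"
      using n by (cases n) auto
    also have "\<dots> \<le> (1 - q ^ j) * 1"
      using qj[of j] binomial_one_success_le_1[of "q ^ j" n] by (intro mult_left_mono) auto
    also have "\<dots> \<le> real j * (1 - q)"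
      using one_minus_power_le[OF q] by simp
    finally have "(1 - q ^ j) ^ n / real j \<le> (1 - q) / (real n * q ^ j)"
      using j n qj[of j] by (simp add: field_simps)
    also have "\<dots> = (1 / q ^ j - 1 / q ^ (j - 1)) / real n"
      using j n q by (cases j) (auto simp: field_simps)
    finally show ?thesis
      by (simp add: diff_divide_distrib)
  qed
  have nonneg: "0 \<le> ?b j" for j
    using qj[of j] by (intro divide_nonneg_nonneg) (auto simp: power_le_one)
  have "(\<Sum>j=1..m. 1 / q ^ j - 1 / q ^ (j - 1)) = 1 / q ^ m - 1"
    by (induction m) auto
  then have "harm m - (1 / q ^ m - 1) / real n
               = (\<Sum>j=1..m. 1 / real j - (1 / q ^ j - 1 / q ^ (j - 1)) / real n)"
    by (simp add: harm_def sum_subtractf sum_divide_distrib[symmetric] inverse_eq_divide)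
  also have "\<dots> \<le> (\<Sum>j=1..m. ?b j)"
    by (rule sum_mono) (rule termwise)
  also have "\<dots> \<le> (\<Sum>j. ?b j)"
    using b by (intro sum_le_suminf nonneg) (auto simp: sums_iff)
  also have "\<dots> = (\<Sum>i=1..n. real (n choose i) * (-1) ^ i * ln (1 - q ^ i))"
    using b by (simp add: sums_iff)
  finally show ?thesis .
qed

text \<open>
  After the cut, Bernoulli's inequality bounds a term by \<open>n * q ^ j / j\<close>, which is dominated by a
  geometric series with prefactor \<open>n / m\<close>.
\<close>

lemma alternating_ln_one_minus_power_le_harm:
  fixes q :: real
  assumes q: "0 < q" "q < 1" and m: "m \<ge> 1"
  shows "(\<Sum>i=1..n. real (n choose i) * (-1) ^ i * ln (1 - q ^ i))
           \<le> harm m + real n * q ^ m / (real m * (1 - q))"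
proof -
  let ?b = "\<lambda>j. (1 - (1 - q ^ j) ^ n) / real j"
  note b = sums_alternating_ln_one_minus_power[OF q, of n]
  have qj: "0 < q ^ j" "q ^ j \<le> 1" for j
    using q by (auto simp: power_le_one)
  have head: "?b j \<le> inverse (real j)" for j
    using qj[of j] by (simp add: inverse_eq_divide divide_right_mono)
  have tail: "?b (j + Suc m) \<le> real n * q ^ m / real m * q ^ j" for j
  proof -
    have "1 - (1 - q ^ (j + Suc m)) ^ n \<le> real n * q ^ (j + Suc m)"
      using Bernoulli_inequality[of "- (q ^ (j + Suc m))" n] qj[of "j + Suc m"] by simp
    also have "\<dots> \<le> real n * q ^ (m + j)"
      using q by (intro mult_left_mono power_decreasing) auto
    finally have "?b (j + Suc m) \<le> real n * q ^ (m + j) / real (j + Suc m)"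
      by (rule divide_right_mono) simp
    also have "\<dots> \<le> real n * q ^ (m + j) / real m"
      using q m by (intro divide_left_mono) auto
    finally show ?thesis by (simp add: power_add)
  qed
  have geo: "(\<lambda>j. real n * q ^ m / real m * q ^ j) sums (real n * q ^ m / real m * (1 / (1 - q)))"
    using q by (intro sums_mult geometric_sums) auto
  have "(\<Sum>i=1..n. real (n choose i) * (-1) ^ i * ln (1 - q ^ i))
          = (\<Sum>j. ?b (j + Suc m)) + (\<Sum>j<Suc m. ?b j)"
    using b suminf_split_initial_segment[of ?b "Suc m"] by (simp add: sums_iff)
  also have "(\<Sum>j<Suc m. ?b j) = (\<Sum>j=1..m. ?b j)"
    by (simp add: lessThan_Suc_atMost atMost_atLeast0 sum.atLeast_Suc_atMost)
  also have "\<dots> \<le> harm m"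
    unfolding harm_def by (rule sum_mono) (rule head)
  also have "(\<Sum>j. ?b (j + Suc m)) \<le> (\<Sum>j. real n * q ^ m / real m * q ^ j)"
  proof (intro suminf_le tail)
    show "summable (\<lambda>j. ?b (j + Suc m))"
      using b by (subst summable_iff_shift) (simp add: sums_iff)
    show "summable (\<lambda>j. real n * q ^ m / real m * q ^ j)"
      using geo by (simp add: sums_iff)
  qed
  also have "\<dots> = real n * q ^ m / (real m * (1 - q))"
    using geo by (simp add: sums_iff)
  finally show ?thesis by simp
qed

text \<open>
  Subtracting \<open>ln (1 - q)\<close> from every logarithm costs a single \<open>ln (1 - q)\<close>, because the signed binomial
  coefficients add up to \<open>- 1\<close>; what remains are the quotients \<open>(1 - q ^ i) / (1 - q) \<rightarrow> i\<close>.
\<close>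

lemma tendsto_alternating_ln_sum:
  fixes K :: real
  assumes K: "K > 0" and n: "n \<ge> 1"
  shows "(\<lambda>m. (\<Sum>i=1..n. real (n choose i) * (-1) ^ i * ln (1 - exp (- K / real m) ^ i))
                + ln (1 - exp (- K / real m)))
           \<longlonglongrightarrow> (\<Sum>i=1..n. real (n choose i) * (-1) ^ i * ln (real i))"
proof -
  have "(\<lambda>m. \<Sum>i=1..n. real (n choose i) * (-1) ^ i
               * (ln (1 - exp (- K / real m) ^ i) - ln (1 - exp (- K / real m))))
          \<longlonglongrightarrow> (\<Sum>i=1..n. real (n choose i) * (-1) ^ i * ln (real i))"
  proof (intro tendsto_sum tendsto_mult tendsto_const)
    fix i assume "i \<in> {1..n}"
    then have "real i > 0" by simp
    then have "(\<lambda>m. ln (1 - exp (real i * (- K / real m))) - ln (1 - exp (- K / real m)))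
                 \<longlonglongrightarrow> ln (real i * K) - ln K"
      using K by real_asymp
    then have "(\<lambda>m. ln (1 - exp (real i * (- K / real m))) - ln (1 - exp (- K / real m)))
                 \<longlonglongrightarrow> ln (real i)"
      using K \<open>real i > 0\<close> by (simp add: ln_mult)
    then show "(\<lambda>m. ln (1 - exp (- K / real m) ^ i) - ln (1 - exp (- K / real m)))
                 \<longlonglongrightarrow> ln (real i)"
      by (simp only: exp_of_nat_mult)
  qed
  moreover have "(\<Sum>i=1..n. real (n choose i) * (-1) ^ i * (a i - c))
                   = (\<Sum>i=1..n. real (n choose i) * (-1) ^ i * a i) + c" for a c
  proof -
    have "(\<Sum>i=1..n. real (n choose i) * (-1) ^ i) = -1"
      using sum_choose_alternating_power[of n 1] n by simp
    then show ?thesis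
      by (simp add: right_diff_distrib sum_subtractf sum_distrib_right[symmetric])
  qed
  ultimately show ?thesis by simp
qed

lemma tendsto_harm_plus_ln_one_minus_exp:
  fixes K :: real
  assumes K: "K > 0"
  shows "(\<lambda>m. harm m + ln (1 - exp (- K / real m))) \<longlonglongrightarrow> ln K + euler_mascheroni"
proof -
  have "(\<lambda>m. (harm m - ln (real m)) + (ln (real m) + ln (1 - exp (- K / real m))))
          \<longlonglongrightarrow> euler_mascheroni + ln K"
  proof (intro tendsto_add euler_mascheroni_LIMSEQ)
    show "(\<lambda>m. ln (real m) + ln (1 - exp (- K / real m))) \<longlonglongrightarrow> ln K"
      using K by real_asymp
  qed
  then show ?thesis by (simp add: add.commute)
qed

text \<open>
  The two bounds below arise by cutting the series at \<open>j = m\<close> for \<open>q = exp (- K / m)\<close>, so that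
  \<open>q ^ m = exp (- K)\<close> stays fixed while \<open>m \<rightarrow> \<infinity>\<close>.  The cut \<open>K\<close> is left free: the lower bound
  loses before the cut and the upper bound after it, so the former wants an earlier cut.
\<close>

lemma alternating_ln_sum_ge:
  fixes K :: real
  assumes K: "K > 0" and n: "n \<ge> 1"
  shows "ln K + euler_mascheroni - (exp K - 1) / real n
           \<le> (\<Sum>i=1..n. real (n choose i) * (-1) ^ i * ln (real i))"
proof (rule LIMSEQ_le[OF _ tendsto_alternating_ln_sum[OF K n]])
  show "(\<lambda>m. harm m + ln (1 - exp (- K / real m)) - (exp K - 1) / real n)
          \<longlonglongrightarrow> ln K + euler_mascheroni - (exp K - 1) / real n"
    by (intro tendsto_diff tendsto_const tendsto_harm_plus_ln_one_minus_exp K)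
  have "harm m + ln (1 - exp (- K / real m)) - (exp K - 1) / real n
          \<le> (\<Sum>i=1..n. real (n choose i) * (-1) ^ i * ln (1 - exp (- K / real m) ^ i))
              + ln (1 - exp (- K / real m))" if "m \<ge> 1" for m
  proof -
    have "exp (- K / real m) ^ m = exp (- K)"
      using that by (simp add: exp_of_nat_mult[symmetric])
    then show ?thesis
      using alternating_ln_one_minus_power_ge_harm[of "exp (- K / real m)" n m] K n that
      by (simp add: exp_minus[of K] inverse_eq_divide[symmetric])
  qed
  then show "\<exists>N. \<forall>m\<ge>N. harm m + ln (1 - exp (- K / real m)) - (exp K - 1) / real n
          \<le> (\<Sum>i=1..n. real (n choose i) * (-1) ^ i * ln (1 - exp (- K / real m) ^ i))
              + ln (1 - exp (- K / real m))"
    by blast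
qed

lemma alternating_ln_sum_le:
  fixes K :: real
  assumes K: "K > 0" and n: "n \<ge> 1"
  shows "(\<Sum>i=1..n. real (n choose i) * (-1) ^ i * ln (real i))
           \<le> ln K + euler_mascheroni + real n * exp (- K) / K"
proof (rule LIMSEQ_le[OF tendsto_alternating_ln_sum[OF K n]])
  have "(\<lambda>m. real m * (1 - exp (- K / real m))) \<longlonglongrightarrow> K"
    using K by real_asymp
  then show "(\<lambda>m. harm m + ln (1 - exp (- K / real m))
                + real n * exp (- K) / (real m * (1 - exp (- K / real m))))
          \<longlonglongrightarrow> ln K + euler_mascheroni + real n * exp (- K) / K"
    using K by (intro tendsto_add tendsto_divide tendsto_const tendsto_harm_plus_ln_one_minus_exp) auto
  have "(\<Sum>i=1..n. real (n choose i) * (-1) ^ i * ln (1 - exp (- K / real m) ^ i))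
          + ln (1 - exp (- K / real m))
          \<le> harm m + ln (1 - exp (- K / real m))
              + real n * exp (- K) / (real m * (1 - exp (- K / real m)))" if "m \<ge> 1" for m
  proof -
    have "exp (- K / real m) ^ m = exp (- K)"
      using that by (simp add: exp_of_nat_mult[symmetric])
    then show ?thesis
      using alternating_ln_one_minus_power_le_harm[of "exp (- K / real m)" m n] K that
      by simp
  qed
  then show "\<exists>N. \<forall>m\<ge>N.
          (\<Sum>i=1..n. real (n choose i) * (-1) ^ i * ln (1 - exp (- K / real m) ^ i))
            + ln (1 - exp (- K / real m))
          \<le> harm m + ln (1 - exp (- K / real m))
              + real n * exp (- K) / (real m * (1 - exp (- K / real m)))"
    by blast
qed

theorem lemma3:
  fixes A :: "nat \<Rightarrow> real"
  assumes "\<And>n. n \<ge> 1 \<Longrightarrow> A (n - 1) = (\<Sum>i=1..n. real (n choose i) * (-1) ^ i * ln (real i))"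
  shows "(\<lambda>n. A n - ln (ln (real n))) \<longlonglongrightarrow> euler_mascheroni"
proof (rule tendsto_sandwich)
  let ?L = "\<lambda>n. ln (real (Suc n))"
  let ?K = "\<lambda>n. ?L n - ln (?L n)"
  have A: "A n = (\<Sum>i=1..Suc n. real (Suc n choose i) * (-1) ^ i * ln (real i))" for n
    using assms[of "Suc n"] by simp
  have "eventually (\<lambda>n. ?L n > 0) sequentially"
    by real_asymp
  moreover have "eventually (\<lambda>n. ?K n > 0) sequentially"
    by real_asymp
  ultimately show
    "eventually (\<lambda>n. ln (?K n) + euler_mascheroni - 1 / ?L n - ln (ln (real n))
                       \<le> A n - ln (ln (real n))) sequentially"
  proof eventually_elim
    case (elim n)
    have "(exp (?K n) - 1) / real (Suc n) \<le> exp (?K n) / real (Suc n)"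
      by (intro divide_right_mono) auto
    also have "\<dots> = 1 / ?L n"
      using elim by (simp add: exp_diff)
    finally show ?case
      using alternating_ln_sum_ge[of "?K n" "Suc n"] elim unfolding A by simp
  qed
  have "eventually (\<lambda>n. ?L n > 0) sequentially"
    by real_asymp
  then show
    "eventually (\<lambda>n. A n - ln (ln (real n))
                       \<le> ln (?L n) + euler_mascheroni + 1 / ?L n - ln (ln (real n))) sequentially"
  proof eventually_elim
    case (elim n)
    then show ?case
      using alternating_ln_sum_le[of "?L n" "Suc n"] unfolding A by (simp add: exp_minus)
  qed
  show "(\<lambda>n. ln (?K n) + euler_mascheroni - 1 / ?L n - ln (ln (real n))) \<longlonglongrightarrow> euler_mascheroni"
    by real_asymp
  show "(\<lambda>n. ln (?L n) + euler_mascheroni + 1 / ?L n - ln (ln (real n))) \<longlonglongrightarrow> euler_mascheroni"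
    by real_asymp
qed

end
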